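(* Let $\ell\ge3$, and let $\mathcal{A}_\ell^k(r)$ ($0\le k\le\ell$) be the intermediate arrangement in $\mathbb{C}^\ell$. Then $\mathcal{A}_\ell^k(r)\in\mathcal{DF}$ (i.e. it is divisionally free) if and only if $k\ne0$.
   Context: For integers $\ell\ge2$, $0\le k\le\ell$ and a positive integer $r$, the intermediate arrangement $\mathcal{A}_\ell^k(r)$ is the arrangement of linear hyperplanes in $\mathbb{C}^\ell$ defined by $\prod_{i=1}^kx_i\prod_{1\le i<j\le\ell,\ 0\le n<r}(x_i-\zeta^nx_j)=0$, where $\zeta$ is a primitive $r$-th root of unity. A (central) $\ell$-arrangement $\mathcal{A}$ is a finite set of linear hyperplanes in an $\ell$-dimensional vector space $V$. $L(\mathcal{A})$ is the set of all intersections of subsets of $\mathcal{A}$ (with $V$ the empty intersection), and $L_i(\mathcal{A})=\{X\in L(\mathcal{A})\mid\mathrm{codim}_VX=i\}$. For $X\in L(\mathcal{A})$, the restriction is $\mathcal{A}^X=\{H\cap X\mid H\in\mathcal{A},\ H\not\supset X\}$, an arrangement in $X$. The Möbius function is given by $\mu(V)=1$ and $\mu(X)=-\sum_{Y\in L(\mathcal{A}),\,X\subsetneq Y}\mu(Y)$ for $X\ne V$, and the characteristic polynomial is $\chi(\mathcal{A};t)=\sum_{X\in L(\mathcal{A})}\mu(X)t^{\dim X}$. An $\ell$-arrangement $\mathcal{A}$ is divisionally free if there is a flag $V=X_0\supset X_1\supset\cdots\supset X_{\ell-2}$ with $X_i\in L_i(\mathcal{A})$ for $i=0,\dots,\ell-2$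 and $\chi(\mathcal{A}^{X_{i+1}};t)\mid\chi(\mathcal{A}^{X_i};t)$ for $i=0,\dots,\ell-3$. $\mathcal{DF}_\ell$ is the set of all divisionally free $\ell$-arrangements, and $\mathcal{DF}=\bigcup_{\ell\ge1}\mathcal{DF}_\ell$.
   Formalization: The formal theorem assumes r ≥ 3 when k = 0; for k = 0 and r = 1 or 2 the arrangement is divisionally free (e.g. ℓ = 3, r = 1: t(t−1) divides t(t−1)(t−2)), so the claim fails there. All r ≥ 1 are covered when k ≥ 1. *)

theory Defs
  imports Complex_Main "HOL-Library.Function_Algebras" "HOL-Computational_Algebra.Polynomial"
begin

section \<open>Intersection lattice, restriction and Moebius function\<close>

text \<open>An arrangement is a set \<open>A\<close> of subspaces together with its ambient space \<open>V\<close>. The latter is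
  kept explicit because restrictions live in proper subspaces.\<close>

definition intersection_lattice :: "'b set \<Rightarrow> 'b set set \<Rightarrow> 'b set set" where
  "intersection_lattice V A = {V \<inter> \<Inter>B | B. B \<subseteq> A}"

definition restriction :: "'b set set \<Rightarrow> 'b set \<Rightarrow> 'b set set" where
  "restriction A X = {H \<inter> X | H. H \<in> A \<and> \<not> X \<subseteq> H}"

lemma finite_intersection_lattice: "finite A \<Longrightarrow> finite (intersection_lattice V A)"
  unfolding intersection_lattice_def by simp

text \<open>The recursion goes upwards through the lattice. The guard makes the function total; its
  default value \<open>0\<close> is never used for a finite arrangement and \<open>X\<close> in its lattice.\<close>

function moebius :: "'b set \<Rightarrow> 'b set set \<Rightarrow> 'b set \<Rightarrow> int" where
  "moebius V A X =
    (if X = V then 1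
     else if finite A \<and> X \<in> intersection_lattice V A
       then - (\<Sum>Y\<in>{Y \<in> intersection_lattice V A. X \<subset> Y}. moebius V A Y)
     else 0)"
  by auto
termination
proof (relation "measure (\<lambda>(V, A, X). card {Y \<in> intersection_lattice V A. X \<subset> Y})")
  fix V :: "'b set" and A X Y
  assume fin: "finite A \<and> X \<in> intersection_lattice V A"
    and Y: "Y \<in> {Y \<in> intersection_lattice V A. X \<subset> Y}"
  have "{Z \<in> intersection_lattice V A. Y \<subset> Z} \<subset> {Z \<in> intersection_lattice V A. X \<subset> Z}"
    using Y by blast
  then show "((V, A, Y), (V, A, X)) \<in>
      measure (\<lambda>(V, A, X). card {Y \<in> intersection_lattice V A. X \<subset> Y})"
    using fin by (auto intro!: psubset_card_mono simp: finite_intersection_lattice)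
qed simp

declare moebius.simps [simp del]


section \<open>Divisionally free arrangements\<close>

text \<open>The prefix \<open>local\<close> is needed because the library's interpretation of \<open>vector_space\<close> for real
  vector spaces also makes the new names available unqualified, for the real scalar product.\<close>

context vector_space
begin

definition hyperplane_in :: "'b set \<Rightarrow> 'b set \<Rightarrow> bool" where
  "hyperplane_in V H \<longleftrightarrow> subspace H \<and> H \<subseteq> V \<and> dim V = dim H + 1"

definition is_arrangement :: "nat \<Rightarrow> 'b set \<Rightarrow> 'b set set \<Rightarrow> bool" where
  "is_arrangement l V A \<longleftrightarrow>
     (\<exists>B. finite B \<and> span B = V) \<and> dim V = l \<and> finite A \<and> (\<forall>H\<in>A. local.hyperplane_in V H)"

definition lattice_codim :: "'b set \<Rightarrow> 'b set set \<Rightarrow> nat \<Rightarrow> 'b set set" where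
  "lattice_codim V A i = {X \<in> intersection_lattice V A. dim X + i = dim V}"

definition char_poly_arr :: "'b set \<Rightarrow> 'b set set \<Rightarrow> int poly" where
  "char_poly_arr V A = (\<Sum>X\<in>intersection_lattice V A. monom (moebius V A X) (dim X))"

text \<open>The conditions \<open>i + 2 \<le> l\<close> and \<open>i + 3 \<le> l\<close> express \<open>i \<le> l - 2\<close> and \<open>i \<le> l - 3\<close> over the
  integers, without truncated subtraction.\<close>

definition divisionally_free :: "nat \<Rightarrow> 'b set \<Rightarrow> 'b set set \<Rightarrow> bool" where
  "divisionally_free l V A \<longleftrightarrow> local.is_arrangement l V A \<and>
     (\<exists>X :: nat \<Rightarrow> 'b set. X 0 = V \<and>
        (\<forall>i. i + 2 \<le> l \<longrightarrow> X i \<in> local.lattice_codim V A i) \<and>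
        (\<forall>i. i + 3 \<le> l \<longrightarrow> X (Suc i) \<subset> X i \<and>
           local.char_poly_arr (X (Suc i)) (restriction A (X (Suc i))) dvd
           local.char_poly_arr (X i) (restriction A (X i))))"

definition DF_dim :: "nat \<Rightarrow> ('b set \<times> 'b set set) set" where
  "DF_dim l = {(V, A). local.divisionally_free l V A}"

definition DF :: "('b set \<times> 'b set set) set" where
  "DF = (\<Union>l\<in>{1..}. local.DF_dim l)"

end


section \<open>Intermediate arrangements\<close>

text \<open>The space \<open>\<complex>\<^sup>l\<close> is the subspace of all \<open>x :: nat \<Rightarrow> complex\<close> supported in \<open>{1..l}\<close>.\<close>

definition cscale :: "complex \<Rightarrow> (nat \<Rightarrow> complex) \<Rightarrow> (nat \<Rightarrow> complex)" where
  "cscale c x = (\<lambda>i. c * x i)"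

global_interpretation cfun: vector_space cscale
  by unfold_locales (auto simp: cscale_def fun_eq_iff algebra_simps)

definition cspace :: "nat \<Rightarrow> (nat \<Rightarrow> complex) set" where
  "cspace l = {x. \<forall>i. i \<notin> {1..l} \<longrightarrow> x i = 0}"

definition primitive_root_of_unity :: "nat \<Rightarrow> complex \<Rightarrow> bool" where
  "primitive_root_of_unity r \<zeta> \<longleftrightarrow> r > 0 \<and> \<zeta> ^ r = 1 \<and> (\<forall>m. 0 < m \<and> m < r \<longrightarrow> \<zeta> ^ m \<noteq> 1)"

definition intermediate_arrangement ::
    "nat \<Rightarrow> nat \<Rightarrow> nat \<Rightarrow> complex \<Rightarrow> (nat \<Rightarrow> complex) set set" where
  "intermediate_arrangement l k r \<zeta> =
     {{x \<in> cspace l. x i = 0} | i. i \<in> {1..k}} \<union>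
     {{x \<in> cspace l. x i - \<zeta> ^ n * x j = 0} | i j n. 1 \<le> i \<and> i < j \<and> j \<le> l \<and> n < r}"

end

theory Submission
  imports Defs "HOL-Library.Indicator_Function"
begin

text \<open>
  Over an infinite field no vector space is a finite union of proper subspaces. Hence the indicator
  functions of distinct subspaces are linearly independent
  (\<open>indicators_of_subspaces_independent\<close>), and there is a well-defined additive functional on their
  span that sends the indicator of \<open>X\<close> to \<open>t ^ dim X\<close> (\<open>subspace_valuation_unique\<close>). By the defining
  recursion of the Moebius function, the characteristic polynomial of an arrangement is the value of
  this functional on the complement of its hyperplanes (\<open>subspace_valuation_complement\<close>).
  Characteristic polynomials can therefore be computed as if the points of the complement were
  counted over a field with \<open>t\<close> elements, one coordinate after the other.

  Adding a coordinate to a point of the complement of the full monomial arrangement \<open>\<A>\<^sub>m\<^sup>m(r)\<close>, one has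
  to avoid \<open>0\<close> and the \<open>m r\<close> distinct values \<open>\<zeta>\<^sup>n x\<^sub>j\<close>. So its characteristic polynomial is
  \<open>f\<^sub>m = (t - 1) (t - (r + 1)) \<dots> (t - ((m - 1) r + 1))\<close>. A point of the complement of \<open>\<A>\<^sub>m\<^sup>k(r)\<close> has at most one zero
  coordinate, at one of \<open>m - k\<close> places. This gives the characteristic polynomial
  \<open>f\<^sub>m + (m - k) f\<^sub>m\<^sub>-\<^sub>1 = f\<^sub>m\<^sub>-\<^sub>1 (t - ((m - 1) r + 1 - m + k))\<close>.

  If \<open>k \<noteq> 0\<close>, the restriction to \<open>x\<^sub>1 = 0\<close> is the full monomial arrangement in one dimension less, with
  characteristic polynomial \<open>f\<^sub>l\<^sub>-\<^sub>1\<close>, and so on: the flag \<open>x\<^sub>1 = \<dots> = x\<^sub>i = 0\<close> shows divisional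
  freeness. If \<open>k = 0\<close>, the restriction to any hyperplane is, up to a linear isomorphism, of type
  \<open>\<A>\<^sub>l\<^sub>-\<^sub>1\<^sup>1(r)\<close>. Divisibility would make its last root \<open>(l - 2) r + 3 - l\<close> equal to
  \<open>(l - 2) r + 1\<close> or to \<open>(l - 1) r + 1 - l\<close>, that is, \<open>l = 2\<close> or \<open>r = 2\<close>; both are excluded.
\<close>

section \<open>Subspaces over an infinite field\<close>

context vector_space
begin

lemma dim_span_insert:
  assumes "subspace X" "X \<subseteq> span T" "finite T" "e \<notin> X"
  shows "dim (span (insert e X)) = dim X + 1"
proof -
  obtain B where B: "B \<subseteq> X" "independent B" "X \<subseteq> span B" "card B = dim X"
    using basis_exists by blast
  have spB: "span B = X" using B assms(1) span_minimal by blast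
  have "finite B" using independent_span_bound[OF assms(3) B(2)] B(1) assms(2) by blast
  show ?thesis
  proof (rule dim_unique)
    show "insert e B \<subseteq> span (insert e X)" using B by (auto intro: span_base)
    show "span (insert e X) \<subseteq> span (insert e B)"
      by (rule span_minimal) (use spB span_mono[of B "insert e B"] in \<open>auto intro: span_base\<close>)
    show "independent (insert e B)" using independent_insert B spB assms(4) by auto
    show "card (insert e B) = dim X + 1"
      using \<open>finite B\<close> B assms(4) by (metis Suc_eq_plus1 card_insert_disjoint subsetD)
  qed
qed

lemma subspace_eq_if_dim_le:
  assumes X: "subspace X" and Y: "subspace Y" "X \<subseteq> Y" "Y \<subseteq> span T" "finite T"
    and le: "dim Y \<le> dim X"
  shows "X = Y"
proof (rule ccontr)
  assume "X \<noteq> Y"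
  then obtain e where e: "e \<in> Y" "e \<notin> X" using Y(2) by blast
  obtain B where B: "B \<subseteq> Y" "independent B" "Y \<subseteq> span B" "card B = dim Y"
    using basis_exists by blast
  have "finite B" using independent_span_bound[OF Y(4) B(2)] B(1) Y(3) by blast
  have "span (insert e X) \<subseteq> Y" using e Y(1,2) by (intro span_minimal) auto
  then have "dim (span (insert e X)) \<le> card B"
    using B(3) \<open>finite B\<close> by (intro dim_le_card) auto
  moreover have "dim (span (insert e X)) = dim X + 1"
    using local.dim_span_insert[OF X _ Y(4) e(2)] Y by blast
  ultimately show False using B(4) le by simp
qed

lemma dim_inj_image:
  assumes lin: "Vector_Spaces.linear scale scale f" and inj: "inj f" and X: "subspace X"
  shows "dim (f ` X) = dim X"
proof -
  interpret p: vector_space_pair scale scale by unfold_locales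
  obtain B where B: "B \<subseteq> X" "independent B" "X \<subseteq> span B" "card B = dim X"
    using basis_exists by blast
  show ?thesis
  proof (rule dim_unique)
    show "f ` B \<subseteq> f ` X" using B by auto
    show "f ` X \<subseteq> span (f ` B)" using B p.linear_span_image[OF lin, of B] by auto
    show "independent (f ` B)"
      using p.linear_independent_injective_image[OF lin B(2)] inj inj_on_subset by blast
    show "card (f ` B) = dim X" using B inj by (metis card_image inj_on_subset subset_UNIV)
  qed
qed

end

locale infinite_vector_space = vector_space scale
  for scale :: "'a::field \<Rightarrow> 'b::ab_group_add \<Rightarrow> 'b" (infixr \<open>*s\<close> 75) +
  assumes infinite_scalars: "infinite (UNIV :: 'a set)"
begin

lemma subspaces_do_not_cover:
  assumes "finite F" "subspace X" "\<And>Y. Y \<in> F \<Longrightarrow> subspace Y" "\<And>Y. Y \<in> F \<Longrightarrow> \<not> X \<subseteq> Y"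
  shows "\<exists>x\<in>X. \<forall>Y\<in>F. x \<notin> Y"
  using assms
proof (induction F rule: finite_induct)
  case empty
  then show ?case using subspace_0 by auto
next
  case (insert Y F)
  then obtain x where x: "x \<in> X" "\<forall>Z\<in>F. x \<notin> Z" by auto
  show ?case
  proof (cases "x \<in> Y")
    case False
    then show ?thesis using x by auto
  next
    case True
    obtain y where y: "y \<in> X" "y \<notin> Y" using insert.prems(3)[of Y] by auto
    have subY: "subspace Y" using insert.prems by auto
    \<comment> \<open>For \<open>y \<in> X - Y\<close>, the line \<open>y + c x\<close> misses \<open>Y\<close> and meets each member of \<open>F\<close> at most once.\<close>
    have "finite {c. y + c *s x \<in> Z}" if "Z \<in> F" for Z
    proof -
      have subZ: "subspace Z" using insert.prems that by auto
      have "c = d" if c: "y + c *s x \<in> Z" and d: "y + d *s x \<in> Z" for c d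
      proof (rule ccontr)
        assume "c \<noteq> d"
        have "(c - d) *s x = (y + c *s x) - (y + d *s x)"
          by (simp add: scale_left_diff_distrib)
        also have "\<dots> \<in> Z" using subspace_diff[OF subZ c d] .
        finally have "inverse (c - d) *s ((c - d) *s x) \<in> Z" by (rule subspace_scale[OF subZ])
        then show False using \<open>c \<noteq> d\<close> x \<open>Z \<in> F\<close> by simp
      qed
      then have "\<exists>c. {c. y + c *s x \<in> Z} \<subseteq> {c}" by blast
      then show ?thesis using finite_subset by blast
    qed
    then have "finite (\<Union>Z\<in>F. {c. y + c *s x \<in> Z})" using insert.hyps by auto
    then obtain c where c: "c \<notin> (\<Union>Z\<in>F. {c. y + c *s x \<in> Z})"
      using infinite_scalars ex_new_if_finite by blast
    have "y + c *s x \<notin> Y"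
    proof
      assume "y + c *s x \<in> Y"
      then have "y + c *s x - c *s x \<in> Y"
        using subspace_diff[OF subY] subspace_scale[OF subY True] by blast
      then show False using y by simp
    qed
    moreover have "y + c *s x \<in> X"
      using insert.prems(1) x(1) y(1) subspace_add subspace_scale by blast
    ultimately show ?thesis using c by auto
  qed
qed

lemma indicators_of_subspaces_independent:
  fixes c :: "'b set \<Rightarrow> int"
  assumes "finite F" "\<And>X. X \<in> F \<Longrightarrow> subspace X"
    and zero: "\<And>x. (\<Sum>X\<in>F. c X * indicator X x) = 0"
    and "X \<in> F"
  shows "c X = 0"
proof (rule ccontr)
  assume "c X \<noteq> 0"
  define G where "G = {X \<in> F. c X \<noteq> 0}"
  \<comment> \<open>A maximal member \<open>M\<close> of \<open>G\<close> has a point in no other member; there the sum equals \<open>c M\<close>.\<close>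
  have G: "finite G" "G \<noteq> {}" using assms \<open>c X \<noteq> 0\<close> by (auto simp: G_def)
  then obtain M where M: "M \<in> G" "\<And>Y. Y \<in> G \<Longrightarrow> M \<subseteq> Y \<Longrightarrow> M = Y"
    using finite_has_maximal[of G] by blast
  have "\<exists>x\<in>M. \<forall>Y\<in>G - {M}. x \<notin> Y"
    by (rule subspaces_do_not_cover) (use G M assms in \<open>auto simp: G_def\<close>)
  then obtain x where x: "x \<in> M" "\<forall>Y\<in>G - {M}. x \<notin> Y" by blast
  have "(\<Sum>X\<in>F. c X * indicator X x) = (\<Sum>X\<in>{M}. c X * indicator X x)"
    by (rule sum.mono_neutral_right) (use assms M x in \<open>auto simp: G_def indicator_def\<close>)
  then show False using zero[of x] x M by (auto simp: G_def)
qed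


section \<open>The valuation with values powers of the variable on subspaces\<close>

text \<open>\<open>subspace_valuation U f p\<close>: the integer-valued function \<open>f\<close> is a combination of indicator
  functions of subspaces of \<open>U\<close>, and \<open>p\<close> is what becomes of this combination when the indicator of
  each subspace \<open>X\<close> is replaced by \<open>t ^ dim X\<close>. By \<open>subspace_valuation_unique\<close> below, \<open>f\<close> determines
  \<open>p\<close>.\<close>

inductive subspace_valuation :: "'b set \<Rightarrow> ('b \<Rightarrow> int) \<Rightarrow> int poly \<Rightarrow> bool" for U where
  zero: "subspace_valuation U (\<lambda>_. 0) 0"
| plus: "subspace_valuation U f p \<Longrightarrow> subspace X \<Longrightarrow> X \<subseteq> U \<Longrightarrow>
    subspace_valuation U (\<lambda>x. f x + c * indicator X x) (p + monom c (dim X))"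

lemma subspace_valuation_single:
  assumes "subspace X" "X \<subseteq> U"
  shows "subspace_valuation U (\<lambda>x. c * indicator X x) (monom c (dim X))"
  using subspace_valuation.plus[OF subspace_valuation.zero assms] by simp

lemma subspace_valuation_mono:
  assumes "subspace_valuation U f p" "U \<subseteq> W"
  shows "subspace_valuation W f p"
  using assms(1)
  by induction (use assms(2) in \<open>auto intro: subspace_valuation.intros\<close>)

lemma subspace_valuation_add:
  assumes "subspace_valuation U f p" and "subspace_valuation U g q"
  shows "subspace_valuation U (\<lambda>x. f x + g x) (p + q)"
  using assms(2)
proof induction
  case zero
  then show ?case using assms(1) by simp
next
  case (plus g q X c)
  then show ?case using subspace_valuation.plus[OF plus.IH plus.hyps(2,3), of c]
    by (simp add: add.assoc)
qed

lemma subspace_valuation_diff: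
  assumes "subspace_valuation U f p" and "subspace_valuation U g q"
  shows "subspace_valuation U (\<lambda>x. f x - g x) (p - q)"
  using assms(2)
proof induction
  case zero
  then show ?case using assms(1) by simp
next
  case (plus g q X c)
  then show ?case using subspace_valuation.plus[OF plus.IH plus.hyps(2,3), of "- c"]
    by (simp add: algebra_simps flip: minus_monom)
qed

lemma subspace_valuation_sum:
  assumes "\<And>i. i \<in> I \<Longrightarrow> subspace_valuation U (f i) (p i)"
  shows "subspace_valuation U (\<lambda>x. \<Sum>i\<in>I. f i x) (\<Sum>i\<in>I. p i)"
  using assms
  by (induction I rule: infinite_finite_induct)
     (auto intro: subspace_valuation.zero subspace_valuation_add)

lemma subspace_valuation_coefficients:
  assumes "subspace_valuation U f p"
  shows "\<exists>F c. finite F \<and> (\<forall>X\<in>F. subspace X) \<and> (\<forall>x. f x = (\<Sum>X\<in>F. c X * indicator X x)) \<and>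
    p = (\<Sum>X\<in>F. monom (c X) (dim X))"
  using assms
proof induction
  case zero
  show ?case by (rule exI[of _ "{}"]) simp
next
  case (plus f p Y d)
  then obtain F c where F: "finite F" "\<forall>X\<in>F. subspace X"
    and f: "\<And>x. f x = (\<Sum>X\<in>F. c X * indicator X x)" and p: "p = (\<Sum>X\<in>F. monom (c X) (dim X))"
    by blast
  let ?F = "insert Y F"
  let ?c = "\<lambda>X. (if X \<in> F then c X else 0) + (if X = Y then d else 0)"
  have "f x + d * indicator Y x = (\<Sum>X\<in>?F. ?c X * indicator X x)" for x
  proof -
    have "(\<Sum>X\<in>?F. ?c X * indicator X x) =
        (\<Sum>X\<in>?F. (if X \<in> F then c X * indicator X x else 0)) +
        (\<Sum>X\<in>?F. (if X = Y then d * indicator X x else 0))"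
      unfolding sum.distrib[symmetric] by (rule sum.cong) (auto simp: algebra_simps)
    also have "(\<Sum>X\<in>?F. (if X \<in> F then c X * indicator X x else 0)) = f x"
      unfolding f using F by (intro sum.mono_neutral_cong_right) auto
    also have "(\<Sum>X\<in>?F. (if X = Y then d * indicator X x else 0)) = d * indicator Y x"
      using F by (subst sum.delta) auto
    finally show ?thesis by simp
  qed
  moreover have "p + monom d (dim Y) = (\<Sum>X\<in>?F. monom (?c X) (dim X))"
  proof -
    have "(\<Sum>X\<in>?F. monom (?c X) (dim X)) =
        (\<Sum>X\<in>?F. (if X \<in> F then monom (c X) (dim X) else 0)) +
        (\<Sum>X\<in>?F. (if X = Y then monom d (dim X) else 0))"
      unfolding sum.distrib[symmetric] by (rule sum.cong) (auto simp: add_monom)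
    also have "(\<Sum>X\<in>?F. (if X \<in> F then monom (c X) (dim X) else 0)) = p"
      unfolding p using F by (intro sum.mono_neutral_cong_right) auto
    also have "(\<Sum>X\<in>?F. (if X = Y then monom d (dim X) else 0)) = monom d (dim Y)"
      using F by (subst sum.delta) auto
    finally show ?thesis by simp
  qed
  ultimately show ?case using F plus.hyps(2)
    by (intro exI[of _ ?F] exI[of _ ?c]) auto
qed

lemma subspace_valuation_unique:
  assumes "subspace_valuation U f p" "subspace_valuation W f q"
  shows "p = q"
proof -
  have "subspace_valuation (U \<union> W) (\<lambda>x. f x - f x) (p - q)"
    by (intro subspace_valuation_diff subspace_valuation_mono[OF assms(1)]
        subspace_valuation_mono[OF assms(2)] Un_upper1 Un_upper2)
  then have "subspace_valuation (U \<union> W) (\<lambda>_. 0) (p - q)" by simp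
  from subspace_valuation_coefficients[OF this] obtain F c where F: "finite F" "\<forall>X\<in>F. subspace X"
    and f: "\<And>x. (\<Sum>X\<in>F. c X * indicator X x) = 0" and p: "p - q = (\<Sum>X\<in>F. monom (c X) (dim X))"
    by metis
  have "c X = 0" if "X \<in> F" for X
    using indicators_of_subspaces_independent[of F c X] F f that by blast
  then show ?thesis using p by simp
qed

text \<open>This covers both ways of adding a coordinate: with \<open>L\<close> the projection that forgets it, \<open>W\<close> is
  either everything (\<open>d = 1\<close>) or the graph of a linear form (\<open>d = 0\<close>).\<close>

lemma subspace_valuation_pullback:
  assumes "subspace_valuation U f p" and "W \<subseteq> U'"
    and "\<And>X. subspace X \<Longrightarrow> X \<subseteq> U \<Longrightarrow> subspace (W \<inter> L -` X) \<and> dim (W \<inter> L -` X) = dim X + d"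
  shows "subspace_valuation U' (\<lambda>x. f (L x) * indicator W x) (monom 1 d * p)"
  using assms(1)
proof induction
  case zero
  show ?case using subspace_valuation.zero by simp
next
  case (plus f p X c)
  note X = assms(3)[OF plus.hyps(2,3)]
  have "subspace_valuation U' (\<lambda>x. f (L x) * indicator W x + c * indicator (W \<inter> L -` X) x)
      (monom 1 d * p + monom c (dim (W \<inter> L -` X)))"
    using X assms(2) by (intro subspace_valuation.plus plus.IH) auto
  moreover have "f (L x) * indicator W x + c * indicator (W \<inter> L -` X) x =
      (f (L x) + c * indicator X (L x)) * indicator W x" for x
    by (auto simp: indicator_def)
  moreover have "monom 1 d * p + monom c (dim (W \<inter> L -` X)) = monom 1 d * (p + monom c (dim X))"
    using X by (simp add: distrib_left mult_monom add.commute)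
  ultimately show ?case by simp
qed

text \<open>The defining recursion of the Moebius function says that \<open>\<Sum> \<mu>(Y)\<close>, taken over the flats \<open>Y\<close>
  through a point \<open>x\<close>, is \<open>1\<close> if \<open>x\<close> lies on no hyperplane and \<open>0\<close> otherwise: the flats through \<open>x\<close>
  are those above the smallest one.\<close>

lemma subspace_valuation_complement:
  assumes fin: "finite A" and V: "subspace V"
    and A: "\<And>H. H \<in> A \<Longrightarrow> subspace H" "\<And>H. H \<in> A \<Longrightarrow> \<not> V \<subseteq> H"
  shows "subspace_valuation V (indicator (V - \<Union>A)) (local.char_poly_arr V A)"
proof -
  let ?L = "intersection_lattice V A"
  let ?mu = "moebius V A"
  have L: "subspace X" "X \<subseteq> V" if X: "X \<in> ?L" for X
  proof -
    obtain B where B: "B \<subseteq> A" "X = V \<inter> \<Inter>B" using X unfolding intersection_lattice_def by blast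
    then show "subspace X" "X \<subseteq> V" using A V by (auto intro!: subspace_inter subspace_Inter)
  qed
  have finL: "finite ?L" using fin by (rule finite_intersection_lattice)
  have "(\<Sum>X\<in>?L. ?mu X * indicator X x) = indicator (V - \<Union>A) x" for x
  proof (cases "x \<in> V")
    case False
    then have "(\<Sum>X\<in>?L. ?mu X * indicator X x) = 0"
      using L(2) by (intro sum.neutral) (auto simp: indicator_def)
    then show ?thesis using False by simp
  next
    case True
    define Z where "Z = V \<inter> \<Inter>{H \<in> A. x \<in> H}"
    have ZL: "Z \<in> ?L" unfolding Z_def intersection_lattice_def by blast
    have iff: "x \<in> Y \<longleftrightarrow> Z \<subseteq> Y" if Y: "Y \<in> ?L" for Y
    proof -
      obtain B where B: "B \<subseteq> A" "Y = V \<inter> \<Inter>B"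
        using Y by (auto simp: intersection_lattice_def)
      show ?thesis
      proof
        assume "x \<in> Y"
        then have "B \<subseteq> {H \<in> A. x \<in> H}" using B by auto
        then show "Z \<subseteq> Y" unfolding Z_def B(2) by (intro Int_mono Inter_anti_mono subset_refl)
      next
        assume "Z \<subseteq> Y"
        moreover have "x \<in> Z" using True unfolding Z_def by auto
        ultimately show "x \<in> Y" by auto
      qed
    qed
    have "(\<Sum>X\<in>?L. ?mu X * indicator X x) = (\<Sum>Y\<in>{Y \<in> ?L. Z \<subseteq> Y}. ?mu Y)"
      using finL by (intro sum.mono_neutral_cong_right) (auto simp: indicator_def iff)
    also have "{Y \<in> ?L. Z \<subseteq> Y} = insert Z {Y \<in> ?L. Z \<subset> Y}" using ZL by blast
    also have "(\<Sum>Y\<in>insert Z {Y \<in> ?L. Z \<subset> Y}. ?mu Y) = ?mu Z + (\<Sum>Y\<in>{Y \<in> ?L. Z \<subset> Y}. ?mu Y)"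
      using finL by (subst sum.insert) auto
    also have "\<dots> = of_bool (Z = V)"
    proof (cases "Z = V")
      case True
      have "{Y \<in> ?L. Z \<subset> Y} = {}" using L(2) True by blast
      then show ?thesis unfolding \<open>{Y \<in> ?L. Z \<subset> Y} = {}\<close> using True
        by (simp add: moebius.simps[of V A V])
    next
      case False
      then show ?thesis using fin ZL by (simp add: moebius.simps[of V A Z])
    qed
    also have "\<dots> = indicator (V - \<Union>A) x"
    proof (cases "x \<in> \<Union>A")
      case True
      then obtain H where H: "H \<in> A" "x \<in> H" by blast
      then have "Z \<subseteq> H" unfolding Z_def by blast
      then have "Z \<noteq> V" using A(2)[OF H(1)] by blast
      then show ?thesis using True by simp
    next
      case False
      then have "{H \<in> A. x \<in> H} = {}" by blast
      then have "Z = V" unfolding Z_def by (simp only: Inter_empty Int_UNIV_right)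
      then show ?thesis using False \<open>x \<in> V\<close> by (simp add: indicator_def)
    qed
    finally show ?thesis .
  qed
  then have "indicator (V - \<Union>A) = (\<lambda>x. \<Sum>X\<in>?L. ?mu X * indicator X x)"
    by (intro ext) (rule sym)
  then show ?thesis
    using subspace_valuation_sum[of ?L V, OF subspace_valuation_single[OF L]]
    by (simp add: local.char_poly_arr_def)
qed

corollary char_poly_restriction_eqI:
  assumes "finite A" and "subspace X" and "\<And>H. H \<in> A \<Longrightarrow> subspace H"
    and "{x \<in> X. \<forall>H\<in>A. \<not> X \<subseteq> H \<longrightarrow> x \<notin> H} = M"
    and "subspace_valuation U (indicator M) p"
  shows "local.char_poly_arr X (restriction A X) = p"
proof -
  have "restriction A X \<subseteq> (\<lambda>H. H \<inter> X) ` A" unfolding restriction_def by blast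
  then have "finite (restriction A X)" using assms(1) finite_surj by blast
  moreover have "subspace H \<and> \<not> X \<subseteq> H" if "H \<in> restriction A X" for H
    using that assms(2,3) by (auto simp: restriction_def intro: subspace_inter)
  ultimately have "subspace_valuation X (indicator (X - \<Union>(restriction A X)))
      (local.char_poly_arr X (restriction A X))"
    using assms(2) by (intro subspace_valuation_complement) auto
  moreover have "X - \<Union>(restriction A X) = M"
    unfolding assms(4)[symmetric] restriction_def by blast
  ultimately show ?thesis using assms(5) subspace_valuation_unique by metis
qed

end

global_interpretation cfun: infinite_vector_space cscale
proof
  show "infinite (UNIV :: complex set)" by (rule infinite_UNIV_char_0)
qed


section \<open>Coordinate subspaces\<close>

text \<open>\<open>coord_space S\<close> is \<open>\<complex>\<^sup>S\<close>, realised as the functions supported in \<open>S\<close>.\<close>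

definition coord_space :: "nat set \<Rightarrow> (nat \<Rightarrow> complex) set" where
  "coord_space S = {x. \<forall>i. i \<notin> S \<longrightarrow> x i = 0}"

text \<open>The standard basis vector on the axis \<open>a\<close>.\<close>

definition unit_vector :: "nat \<Rightarrow> nat \<Rightarrow> complex" where
  "unit_vector a = (\<lambda>i. if i = a then 1 else 0)"

lemma cspace_eq_coord_space: "cspace l = coord_space {1..l}"
  by (simp add: cspace_def coord_space_def)

lemma coord_space_mono: "S \<subseteq> T \<Longrightarrow> coord_space S \<subseteq> coord_space T"
  by (auto simp: coord_space_def)

lemma subspace_coord_space: "cfun.subspace (coord_space S)"
  unfolding cfun.subspace_def by (auto simp: coord_space_def cscale_def)

lemma fun_upd_eq_plus_scale: "x(a := 0) = x - cscale (x a) (unit_vector a)"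
  by (auto simp: fun_eq_iff cscale_def unit_vector_def)

text \<open>The vectors whose projection along the axis \<open>a\<close> lies in \<open>X\<close> form \<open>X\<close> plus that axis.\<close>

lemma cylinder_eq_span:
  assumes "cfun.subspace X" "X \<subseteq> coord_space S" "a \<notin> S"
  shows "coord_space (insert a S) \<inter> (\<lambda>x. x(a := 0)) -` X = cfun.span (insert (unit_vector a) X)"
proof -
  have spX: "cfun.span X = X" using assms(1) by (simp add: cfun.span_eq_iff)
  have "x \<in> coord_space (insert a S) \<and> x(a := 0) \<in> X \<longleftrightarrow>
      (\<exists>k. x - cscale k (unit_vector a) \<in> X)" (is "?l \<longleftrightarrow> ?r") for x
  proof
    assume ?l
    then show ?r by (auto simp: fun_upd_eq_plus_scale)
  next
    assume ?r
    then obtain k where k: "x - cscale k (unit_vector a) \<in> X" by blast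
    then have c: "x - cscale k (unit_vector a) \<in> coord_space S" using assms(2) by blast
    then have "(x - cscale k (unit_vector a)) a = 0" using assms(3) by (auto simp: coord_space_def)
    then have "k = x a" by (simp add: cscale_def unit_vector_def)
    then have "x(a := 0) \<in> X" using k by (simp add: fun_upd_eq_plus_scale)
    moreover have "x \<in> coord_space (insert a S)"
    proof -
      have "x(a := 0) \<in> coord_space S" using calculation assms(2) by blast
      then show ?thesis by (auto simp: coord_space_def split: if_splits)
    qed
    ultimately show ?l by simp
  qed
  then show ?thesis unfolding cfun.span_insert spX by blast
qed

lemma coord_space_insert:
  assumes "a \<notin> S"
  shows "coord_space (insert a S) = cfun.span (insert (unit_vector a) (coord_space S))"
  unfolding cylinder_eq_span[OF subspace_coord_space order_refl assms, symmetric]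
  by (auto simp: coord_space_def)

lemma coord_space_eq_span:
  assumes "finite S"
  shows "coord_space S = cfun.span (unit_vector ` S)"
  using assms
proof (induction S rule: finite_induct)
  case empty
  show ?case by (auto simp: coord_space_def)
next
  case (insert a S)
  then show ?case
    unfolding coord_space_insert[OF insert.hyps(2)] insert.IH image_insert cfun.span_insert cfun.span_span
    by simp
qed

lemma unit_vector_notin: "a \<notin> S \<Longrightarrow> unit_vector a \<notin> coord_space S"
  by (auto simp: coord_space_def unit_vector_def)

lemma dim_cylinder:
  assumes "finite S" "cfun.subspace X" "X \<subseteq> coord_space S" "a \<notin> S"
  shows "cfun.dim (coord_space (insert a S) \<inter> (\<lambda>x. x(a := 0)) -` X) = cfun.dim X + 1"
  unfolding cylinder_eq_span[OF assms(2-4)]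
  by (rule cfun.dim_span_insert[where T = "unit_vector ` S"])
     (use assms unit_vector_notin in \<open>auto simp flip: coord_space_eq_span\<close>)

lemma dim_coord_space: "finite S \<Longrightarrow> cfun.dim (coord_space S) = card S"
proof (induction S rule: finite_induct)
  case empty
  show ?case unfolding coord_space_eq_span[OF finite.emptyI]
    using cfun.dim_span_eq_card_independent[OF cfun.independent_empty] by simp
next
  case (insert a S)
  have "coord_space (insert a S) =
      coord_space (insert a S) \<inter> (\<lambda>x. x(a := 0)) -` coord_space S"
    by (auto simp: coord_space_def)
  then show ?case
    using dim_cylinder[OF insert.hyps(1) subspace_coord_space order_refl insert.hyps(2)] insert
    by simp
qed

text \<open>The graph over \<open>X\<close> of the linear form \<open>c x\<^sub>j\<close>, with values on the axis \<open>a\<close>, is the image of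
  \<open>X\<close> under a shear.\<close>

lemma graph_of_coordinate:
  fixes c :: complex
  assumes "cfun.subspace X" "X \<subseteq> coord_space S" "a \<notin> S" "j \<in> S"
  defines "G \<equiv> {x \<in> coord_space (insert a S). x a = c * x j} \<inter> (\<lambda>x. x(a := 0)) -` X"
  shows "cfun.subspace G" "cfun.dim G = cfun.dim X"
proof -
  let ?T = "\<lambda>x :: nat \<Rightarrow> complex. x(a := x a + c * x j)"
  have "a \<noteq> j" using assms(3,4) by blast
  have lin: "Vector_Spaces.linear cscale cscale ?T"
    unfolding Vector_Spaces.linear_iff using cfun.vector_space_axioms
    by (auto simp: fun_eq_iff cscale_def algebra_simps)
  have inj: "inj ?T"
  proof (rule injI)
    fix x y :: "nat \<Rightarrow> complex"
    assume eq: "?T x = ?T y"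
    have other: "x i = y i" if "i \<noteq> a" for i using fun_cong[OF eq, of i] that by simp
    have "x a = y a" using fun_cong[OF eq, of a] other[of j] \<open>a \<noteq> j\<close> by simp
    then show "x = y" using other by (metis ext)
  qed
  have "G = ?T ` X"
  proof
    show "G \<subseteq> ?T ` X"
    proof
      fix x assume "x \<in> G"
      then have x: "x a = c * x j" "x(a := 0) \<in> X" by (auto simp: G_def)
      then have "x = ?T (x(a := 0))" using \<open>a \<noteq> j\<close> by (auto simp: fun_eq_iff)
      then show "x \<in> ?T ` X" using x(2) by blast
    qed
    show "?T ` X \<subseteq> G"
    proof
      fix x assume "x \<in> ?T ` X"
      then obtain y where y: "y \<in> X" "x = ?T y" by blast
      then have "y \<in> coord_space S" using assms(2) by blast
      then have "y a = 0" using assms(3) by (auto simp: coord_space_def)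
      then have "x(a := 0) = y" using y(2) by (auto simp: fun_eq_iff)
      then show "x \<in> G" using y \<open>y a = 0\<close> \<open>y \<in> coord_space S\<close> \<open>a \<noteq> j\<close>
        by (auto simp: G_def coord_space_def)
    qed
  qed
  interpret p: vector_space_pair cscale cscale by unfold_locales
  show "cfun.subspace G" unfolding \<open>G = ?T ` X\<close> by (rule p.linear_subspace_image[OF lin assms(1)])
  show "cfun.dim G = cfun.dim X" unfolding \<open>G = ?T ` X\<close> by (rule cfun.dim_inj_image[OF lin inj assms(1)])
qed

lemma valuation_cylinder:
  assumes "cfun.subspace_valuation (coord_space S) f p" "finite S" "a \<notin> S"
  shows "cfun.subspace_valuation (coord_space (insert a S))
    (\<lambda>x. f (x(a := 0)) * indicator (coord_space (insert a S)) x) ([:0, 1:] * p)"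
proof -
  have "cfun.subspace_valuation (coord_space (insert a S))
    (\<lambda>x. f (x(a := 0)) * indicator (coord_space (insert a S)) x) (monom 1 1 * p)"
    using assms(1) order_refl
  proof (rule cfun.subspace_valuation_pullback)
    fix X assume X: "cfun.subspace X" "X \<subseteq> coord_space S"
    show "cfun.subspace (coord_space (insert a S) \<inter> (\<lambda>x. x(a := 0)) -` X) \<and>
        cfun.dim (coord_space (insert a S) \<inter> (\<lambda>x. x(a := 0)) -` X) = cfun.dim X + 1"
      using dim_cylinder[OF assms(2) X assms(3)] cfun.subspace_span
      unfolding cylinder_eq_span[OF X assms(3)] by blast
  qed
  then show ?thesis by (simp add: monom_altdef)
qed

lemma valuation_graph:
  assumes "cfun.subspace_valuation (coord_space S) f p" "a \<notin> S" "j \<in> S"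
    and "{x \<in> coord_space (insert a S). x a = c * x j} \<subseteq> U"
  shows "cfun.subspace_valuation U
    (\<lambda>x. f (x(a := 0)) * indicator {x \<in> coord_space (insert a S). x a = c * x j} x) p"
proof -
  have "cfun.subspace_valuation U
    (\<lambda>x. f (x(a := 0)) * indicator {x \<in> coord_space (insert a S). x a = c * x j} x) (monom 1 0 * p)"
    using assms(1,4)
    by (rule cfun.subspace_valuation_pullback) (use graph_of_coordinate assms in auto)
  then show ?thesis by (simp add: monom_0)
qed


section \<open>Complements of the intermediate arrangements\<close>

lemma inj_on_powers_primitive_root:
  assumes "primitive_root_of_unity r \<zeta>"
  shows "inj_on (\<lambda>n. \<zeta> ^ n) {..<r}"
proof -
  have r: "r > 0" "\<zeta> ^ r = 1" and prim: "\<And>m. 0 < m \<Longrightarrow> m < r \<Longrightarrow> \<zeta> ^ m \<noteq> 1"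
    using assms by (auto simp: primitive_root_of_unity_def)
  have "\<zeta> \<noteq> 0" using r by (auto simp: power_0_left)
  have less: "\<zeta> ^ m \<noteq> \<zeta> ^ n" if "m < n" "n < r" for m n
  proof
    assume "\<zeta> ^ m = \<zeta> ^ n"
    also have "\<zeta> ^ n = \<zeta> ^ m * \<zeta> ^ (n - m)" using that by (simp flip: power_add)
    finally have "\<zeta> ^ (n - m) = 1" using \<open>\<zeta> \<noteq> 0\<close> by simp
    then show False using prim[of "n - m"] that by simp
  qed
  show ?thesis by (rule linorder_inj_onI) (use less in auto)
qed

lemma power_mult_root_of_unity:
  assumes "primitive_root_of_unity r \<zeta>"
  shows "(\<zeta> ^ n * x) ^ r = x ^ r"
proof -
  have "(\<zeta> ^ n) ^ r = (\<zeta> ^ r) ^ n" by (simp add: mult.commute flip: power_mult)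
  then show ?thesis using assms by (simp add: power_mult_distrib primitive_root_of_unity_def)
qed

lemma sum_roots_of_unity:
  assumes "primitive_root_of_unity r \<zeta>" "y \<noteq> 0"
  shows "(\<Sum>n<r. of_bool (x = \<zeta> ^ n * y)) = (of_bool (x ^ r = y ^ r) :: int)"
proof -
  have r: "r > 0" using assms(1) by (simp add: primitive_root_of_unity_def)
  have inj: "inj_on (\<lambda>n. \<zeta> ^ n) {..<r}" using assms(1) by (rule inj_on_powers_primitive_root)
  have "(\<lambda>n. \<zeta> ^ n) ` {..<r} = {z. z ^ r = 1}"
  proof (rule card_subset_eq)
    show "finite {z :: complex. z ^ r = 1}" using r by (intro finite_roots_unity) auto
    show "(\<lambda>n. \<zeta> ^ n) ` {..<r} \<subseteq> {z. z ^ r = 1}"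
      using power_mult_root_of_unity[OF assms(1), where x = 1] by auto
    show "card ((\<lambda>n. \<zeta> ^ n) ` {..<r}) = card {z :: complex. z ^ r = 1}"
      using r card_image[OF inj] by (simp add: card_roots_unity_eq)
  qed
  then have bij: "bij_betw (\<lambda>n. \<zeta> ^ n) {..<r} {z. z ^ r = 1}" using inj by (simp add: bij_betw_def)
  have "(\<Sum>n<r. of_bool (x = \<zeta> ^ n * y)) = (\<Sum>n<r. of_bool (\<zeta> ^ n = x / y) :: int)"
    using assms(2) by (intro sum.cong) (auto simp: field_simps)
  also have "\<dots> = (\<Sum>z\<in>{z. z ^ r = 1}. of_bool (z = x / y))"
    by (rule sum.reindex_bij_betw[OF bij])
  also have "\<dots> = of_bool ((x / y) ^ r = 1)"
    using r by (simp add: of_bool_def sum.delta finite_roots_unity)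
  also have "\<dots> = of_bool (x ^ r = y ^ r)"
    using assms(2) by (simp add: power_divide)
  finally show ?thesis .
qed

corollary power_eq_iff_root_of_unity:
  assumes "primitive_root_of_unity r \<zeta>"
  shows "x ^ r = y ^ r \<longleftrightarrow> (\<exists>n<r. x = \<zeta> ^ n * y)"
proof (cases "y = 0")
  case True
  then show ?thesis using assms by (auto simp: primitive_root_of_unity_def power_0_left)
next
  case False
  have "(\<exists>n<r. x = \<zeta> ^ n * y) \<longleftrightarrow> (\<Sum>n<r. of_bool (x = \<zeta> ^ n * y) :: int) \<noteq> 0"
    by (subst sum_nonneg_eq_0_iff) auto
  then show ?thesis using sum_roots_of_unity[OF assms False, of x] by simp
qed

text \<open>The complement in \<open>\<complex>\<^sup>S\<close> of the intermediate arrangement whose coordinate hyperplanes are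
  indexed by \<open>K \<subseteq> S\<close>. The condition \<open>x\<^sub>i \<noteq> \<zeta>\<^sup>n x\<^sub>j\<close> for all \<open>n\<close> is expressed by \<open>r\<close>-th powers, which
  makes it symmetric in \<open>i\<close> and \<open>j\<close> and independent of the choice of \<open>\<zeta>\<close>.\<close>

definition intermediate_complement :: "nat \<Rightarrow> nat set \<Rightarrow> nat set \<Rightarrow> (nat \<Rightarrow> complex) set" where
  "intermediate_complement r S K = {x \<in> coord_space S. (\<forall>i\<in>K. x i \<noteq> 0) \<and>
     (\<forall>i\<in>S. \<forall>j\<in>S. i \<noteq> j \<longrightarrow> x i ^ r \<noteq> x j ^ r)}"

text \<open>The characteristic polynomial of the full monomial arrangement in dimension \<open>m\<close>.\<close>

definition monomial_poly :: "nat \<Rightarrow> nat \<Rightarrow> int poly" where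
  "monomial_poly r m = (\<Prod>i<m. [:- (int i * int r + 1), 1:])"

text \<open>The cylinder over the complement for \<open>S\<close> is the disjoint union of the complement for
  \<open>insert a S\<close>, the part \<open>x\<^sub>a = 0\<close>, and the graphs \<open>x\<^sub>a = \<zeta>\<^sup>n x\<^sub>j\<close>.\<close>

lemma valuation_monomial_complement:
  assumes "finite S" and z: "primitive_root_of_unity r \<zeta>"
  shows "cfun.subspace_valuation (coord_space S) (indicator (intermediate_complement r S S))
    (monomial_poly r (card S))"
  using assms(1)
proof (induction S rule: finite_induct)
  case empty
  have "intermediate_complement r {} {} = coord_space {}"
    by (simp add: intermediate_complement_def)
  moreover have "monomial_poly r 0 = monom 1 (cfun.dim (coord_space {}))"
    by (simp add: monomial_poly_def dim_coord_space)
  ultimately show ?case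
    using cfun.subspace_valuation_single[OF subspace_coord_space[of "{}"] order_refl, of 1] by simp
next
  case (insert a S)
  have "r > 0" using z by (simp add: primitive_root_of_unity_def)
  let ?C = "coord_space (insert a S)"
  let ?F = "intermediate_complement r S S"
  let ?W = "\<lambda>j n. {x \<in> ?C. x a = \<zeta> ^ n * x j}"
  let ?p = "monomial_poly r (card S)"
  have "cfun.subspace_valuation ?C
      (\<lambda>x. indicator ?F (x(a := 0)) * indicator ?C x - indicator ?F x -
        (\<Sum>j\<in>S. \<Sum>n<r. indicator ?F (x(a := 0)) * indicator (?W j n) x))
      ([:0, 1:] * ?p - ?p - (\<Sum>j\<in>S. \<Sum>n<r. ?p))"
    using insert.hyps
    by (intro cfun.subspace_valuation_diff cfun.subspace_valuation_sum valuation_cylinder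
        valuation_graph insert.IH cfun.subspace_valuation_mono[OF insert.IH] coord_space_mono) auto
  moreover have "indicator ?F (x(a := 0)) * indicator ?C x - indicator ?F x -
        (\<Sum>j\<in>S. \<Sum>n<r. indicator ?F (x(a := 0)) * indicator (?W j n) x) =
      (indicator (intermediate_complement r (insert a S) (insert a S)) x :: int)" (is "?l x = ?r x") for x
  proof (cases "x \<in> ?C \<and> x(a := 0) \<in> ?F")
    case False
    have "x \<notin> intermediate_complement r (insert a S) (insert a S)"
    proof
      assume x: "x \<in> intermediate_complement r (insert a S) (insert a S)"
      then have C: "x \<in> ?C" by (simp add: intermediate_complement_def)
      then have "x(a := 0) \<in> coord_space S" by (auto simp: coord_space_def)
      moreover have "i \<noteq> a" if "i \<in> S" for i using that insert.hyps by blast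
      ultimately have "x(a := 0) \<in> ?F" using x by (simp add: intermediate_complement_def)
      then show False using False C by blast
    qed
    moreover have "x \<notin> ?F"
    proof
      assume x: "x \<in> ?F"
      then have "x a = 0" using insert.hyps by (auto simp: intermediate_complement_def coord_space_def)
      then have "x(a := 0) = x" by (auto simp: fun_eq_iff)
      moreover have "x \<in> ?C" using x by (auto simp: intermediate_complement_def coord_space_def)
      ultimately show False using False x by simp
    qed
    moreover have 1: "indicator ?F (x(a := 0)) * indicator (?W j n) x = (0::int)" for j n
      using False by (auto simp: indicator_def)
    moreover have 2: "indicator ?F (x(a := 0)) * indicator ?C x = (0::int)"
      using False by (auto simp: indicator_def)
    ultimately show ?thesis unfolding 1 2 by simp
  next
    case True
    have upd: "(x(a := 0)) i = x i" if "i \<in> S" for i using that insert.hyps(2) by auto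
    have ne: "x j \<noteq> 0" and diff: "i \<in> S \<Longrightarrow> i \<noteq> j \<Longrightarrow> x i ^ r \<noteq> x j ^ r" if "j \<in> S" for i j
      using True that upd by (auto simp: intermediate_complement_def simp del: fun_upd_apply)
    have "(\<Sum>j\<in>S. \<Sum>n<r. indicator ?F (x(a := 0)) * indicator (?W j n) x) =
        (\<Sum>j\<in>S. of_bool (x a ^ r = x j ^ r) :: int)"
    proof (intro sum.cong refl)
      fix j assume "j \<in> S"
      have "(\<Sum>n<r. indicator ?F (x(a := 0)) * indicator (?W j n) x) =
          (\<Sum>n<r. of_bool (x a = \<zeta> ^ n * x j) :: int)"
        using True by (intro sum.cong) (auto simp: indicator_def)
      then show "(\<Sum>n<r. indicator ?F (x(a := 0)) * indicator (?W j n) x) =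
          (of_bool (x a ^ r = x j ^ r) :: int)"
        using sum_roots_of_unity[OF z ne[OF \<open>j \<in> S\<close>]] by simp
    qed
    also have "\<dots> = of_bool (\<exists>j\<in>S. x a ^ r = x j ^ r)"
    proof (cases "\<exists>j\<in>S. x a ^ r = x j ^ r")
      case ex: True
      then obtain j where j: "j \<in> S" "x a ^ r = x j ^ r" by blast
      have "(\<Sum>j\<in>S. of_bool (x a ^ r = x j ^ r) :: int) = (\<Sum>i\<in>S. of_bool (i = j))"
        using j diff by (intro sum.cong) auto
      then show ?thesis using ex j insert.hyps by (simp add: of_bool_def sum.delta)
    next
      case False
      then show ?thesis by simp
    qed
    finally have s: "(\<Sum>j\<in>S. \<Sum>n<r. indicator ?F (x(a := 0)) * indicator (?W j n) x) =
      (of_bool (\<exists>j\<in>S. x a ^ r = x j ^ r) :: int)" .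
    have F: "x \<in> ?F \<longleftrightarrow> x a = 0"
    proof
      assume "x \<in> ?F"
      then show "x a = 0" using insert.hyps by (auto simp: intermediate_complement_def coord_space_def)
    next
      assume "x a = 0"
      then have "x(a := 0) = x" by (auto simp: fun_eq_iff)
      then show "x \<in> ?F" using True by simp
    qed
    have G: "x \<in> intermediate_complement r (insert a S) (insert a S) \<longleftrightarrow>
        x a \<noteq> 0 \<and> \<not> (\<exists>j\<in>S. x a ^ r = x j ^ r)"
    proof
      assume "x \<in> intermediate_complement r (insert a S) (insert a S)"
      then show "x a \<noteq> 0 \<and> \<not> (\<exists>j\<in>S. x a ^ r = x j ^ r)"
        using insert.hyps by (auto simp: intermediate_complement_def)
    next
      assume "x a \<noteq> 0 \<and> \<not> (\<exists>j\<in>S. x a ^ r = x j ^ r)"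
      then show "x \<in> intermediate_complement r (insert a S) (insert a S)"
        using True ne diff insert.hyps unfolding intermediate_complement_def by fastforce
    qed
    have zero: "\<not> (\<exists>j\<in>S. x a ^ r = x j ^ r)" if "x a = 0"
      using that ne \<open>r > 0\<close> by (auto simp: power_0_left)
    show ?thesis unfolding s using True zero by (auto simp: indicator_def F G)
  qed
  moreover have "[:0, 1:] * ?p - ?p - (\<Sum>j\<in>S. \<Sum>n<r. ?p) = monomial_poly r (card (insert a S))"
  proof -
    have "(\<Sum>j\<in>S. \<Sum>n<r. ?p) = [:int (card S) * int r:] * ?p"
      by (simp add: of_nat_poly mult.assoc mult.commute[of "card S" r] flip: of_nat_mult)
    then have "[:0, 1:] * ?p - ?p - (\<Sum>j\<in>S. \<Sum>n<r. ?p) =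
        ([:0, 1:] - 1 - [:int (card S) * int r:]) * ?p"
      by (simp only: left_diff_distrib mult_1_left)
    also have "[:0, 1:] - 1 - [:int (card S) * int r:] = [:- (int (card S) * int r + 1), 1:]"
      by (simp add: one_pCons)
    finally show ?thesis using insert.hyps by (simp add: monomial_poly_def)
  qed
  ultimately show ?case by simp
qed

text \<open>A point of the complement has at most one vanishing coordinate, so the complement splits into
  pieces that belong to full monomial arrangements.\<close>

lemma valuation_intermediate_complement:
  assumes "finite S" "S \<noteq> {}" "K \<subseteq> S" and z: "primitive_root_of_unity r \<zeta>"
  shows "cfun.subspace_valuation (coord_space S) (indicator (intermediate_complement r S K))
    (monomial_poly r (card S - 1) *
      [:- ((int (card S) - 1) * int r + 1 - int (card S) + int (card K)), 1:])"
proof -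
  have "r > 0" using z by (simp add: primitive_root_of_unity_def)
  let ?F = "\<lambda>S. intermediate_complement r S S"
  let ?p = "monomial_poly r (card S - 1)"
  have "cfun.subspace_valuation (coord_space S)
      (\<lambda>x. indicator (?F S) x + (\<Sum>j\<in>S - K. indicator (?F (S - {j})) x))
      (monomial_poly r (card S) + (\<Sum>j\<in>S - K. ?p))"
  proof (intro cfun.subspace_valuation_add cfun.subspace_valuation_sum
      valuation_monomial_complement[OF assms(1) z])
    fix j assume "j \<in> S - K"
    then show "cfun.subspace_valuation (coord_space S) (indicator (?F (S - {j}))) ?p"
      using cfun.subspace_valuation_mono[OF
          valuation_monomial_complement[OF _ z, of "S - {j}"] coord_space_mono[of _ S]] assms(1)
      by auto
  qed
  moreover have "indicator (?F S) x + (\<Sum>j\<in>S - K. indicator (?F (S - {j})) x) =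
      (indicator (intermediate_complement r S K) x :: int)" for x
  proof -
    have piece: "x \<in> ?F (S - {j}) \<longleftrightarrow> x \<in> intermediate_complement r S K \<and> x j = 0"
      if "j \<in> S - K" for j
    proof
      assume x: "x \<in> ?F (S - {j})"
      then have j: "x j = 0" by (auto simp: intermediate_complement_def coord_space_def)
      have ne: "x i \<noteq> 0" if "i \<in> S" "i \<noteq> j" for i
        using x that by (auto simp: intermediate_complement_def)
      have "x i ^ r \<noteq> x k ^ r" if "i \<in> S" "k \<in> S" "i \<noteq> k" for i k
      proof (cases "i = j \<or> k = j")
        case True
        then show ?thesis using that j ne \<open>r > 0\<close> by (auto simp: power_0_left)
      next
        case False
        then show ?thesis using x that by (auto simp: intermediate_complement_def)
      qed
      then show "x \<in> intermediate_complement r S K \<and> x j = 0"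
        using x j ne assms(3) \<open>j \<in> S - K\<close>
        unfolding intermediate_complement_def coord_space_def mem_Collect_eq
        by (metis DiffD1 DiffD2 DiffI empty_iff insert_iff subsetD)
    next
      assume x: "x \<in> intermediate_complement r S K \<and> x j = 0"
      have "x i \<noteq> 0" if "i \<in> S" "i \<noteq> j" for i
        using x that \<open>j \<in> S - K\<close> by (force simp: intermediate_complement_def)
      then show "x \<in> ?F (S - {j})"
        using x by (auto simp: intermediate_complement_def coord_space_def)
    qed
    show ?thesis
    proof (cases "x \<in> intermediate_complement r S K")
      case False
      then have "x \<notin> ?F S" using assms(3) by (auto simp: intermediate_complement_def)
      then show ?thesis using False piece by simp
    next
      case True
      show ?thesis
      proof (cases "\<exists>j\<in>S. x j = 0")
        case False
        then have "x \<in> ?F S" using True by (auto simp: intermediate_complement_def)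
        then show ?thesis using True False piece by simp
      next
        case ex: True
        then obtain j where j: "j \<in> S" "x j = 0" by blast
        then have "j \<in> S - K" using True by (auto simp: intermediate_complement_def)
        have unique: "i = j" if "i \<in> S" "x i = 0" for i
          using True that j by (force simp: intermediate_complement_def)
        have "(\<Sum>i\<in>S - K. indicator (?F (S - {i})) x) = (\<Sum>i\<in>S - K. of_bool (i = j) :: int)"
        proof (intro sum.cong refl)
          fix i assume i: "i \<in> S - K"
          have "x \<in> ?F (S - {i}) \<longleftrightarrow> i = j" using piece[OF i] True unique[of i] i j(2) by blast
          then show "indicator (?F (S - {i})) x = (of_bool (i = j) :: int)"
            by (simp add: indicator_def)
        qed
        moreover have "x \<notin> ?F S" using j by (auto simp: intermediate_complement_def)
        ultimately show ?thesis
          using True \<open>j \<in> S - K\<close> assms(1) by (simp add: of_bool_def sum.delta)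
      qed
    qed
  qed
  moreover have "monomial_poly r (card S) + (\<Sum>j\<in>S - K. ?p) =
      ?p * [:- ((int (card S) - 1) * int r + 1 - int (card S) + int (card K)), 1:]"
  proof -
    obtain m where m: "card S = Suc m" using assms(1,2) by (metis card_0_eq not0_implies_Suc)
    have K: "card K \<le> Suc m" using card_mono[OF assms(1,3)] m by simp
    have "card (S - K) = Suc m - card K" using assms m by (metis card_Diff_subset finite_subset)
    then have "(\<Sum>j\<in>S - K. ?p) = ?p * [:int (Suc m) - int (card K):]"
      using K by (simp add: of_nat_poly of_nat_diff)
    moreover have "monomial_poly r (card S) = ?p * [:- (int m * int r + 1), 1:]"
      using m by (simp add: monomial_poly_def)
    ultimately have "monomial_poly r (card S) + (\<Sum>j\<in>S - K. ?p) =
        ?p * ([:- (int m * int r + 1), 1:] + [:int (Suc m) - int (card K):])"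
      by (simp only: distrib_left)
    then show ?thesis using m by (simp add: algebra_simps)
  qed
  ultimately show ?thesis by simp
qed


section \<open>Restrictions of the intermediate arrangements\<close>

lemma finite_intermediate_arrangement: "finite (intermediate_arrangement l k r \<zeta>)"
proof -
  have "intermediate_arrangement l k r \<zeta> \<subseteq>
      (\<lambda>i. {x \<in> cspace l. x i = 0}) ` {1..k} \<union>
      (\<lambda>(i, j, n). {x \<in> cspace l. x i - \<zeta> ^ n * x j = 0}) ` ({1..l} \<times> {1..l} \<times> {..<r})"
    unfolding intermediate_arrangement_def by (force simp: image_iff)
  then show ?thesis by (rule finite_subset) auto
qed

lemma diagonal_hyperplane:
  assumes "1 \<le> i" "i \<le> l" "1 \<le> j" "j \<le> l" "i \<noteq> j"
  shows "cfun.subspace {x \<in> cspace l. x i - c * x j = 0}"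
    "cfun.dim {x \<in> cspace l. x i - c * x j = 0} = l - 1"
proof -
  let ?S = "{1..l} - {i}"
  have ins: "insert i ?S = {1..l}" using assms by auto
  have "{x \<in> cspace l. x i - c * x j = 0} =
      {x \<in> coord_space (insert i ?S). x i = c * x j} \<inter> (\<lambda>x. x(i := 0)) -` coord_space ?S"
    unfolding ins cspace_eq_coord_space by (auto simp: coord_space_def)
  then show "cfun.subspace {x \<in> cspace l. x i - c * x j = 0}"
    "cfun.dim {x \<in> cspace l. x i - c * x j = 0} = l - 1"
    using graph_of_coordinate[OF subspace_coord_space order_refl, of i ?S j c] assms
    by (auto simp: dim_coord_space)
qed

lemma intermediate_arrangement_hyperplane:
  assumes "k \<le> l" "H \<in> intermediate_arrangement l k r \<zeta>"
  shows "cfun.hyperplane_in (cspace l) H"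
proof -
  consider (coord) i where "i \<in> {1..k}" "H = {x \<in> cspace l. x i = 0}"
    | (diag) i j n where "1 \<le> i" "i < j" "j \<le> l" "H = {x \<in> cspace l. x i - \<zeta> ^ n * x j = 0}"
    using assms(2) unfolding intermediate_arrangement_def by blast
  then show ?thesis
  proof cases
    case coord
    then have "H = coord_space ({1..l} - {i})"
      by (auto simp: cspace_eq_coord_space coord_space_def)
    moreover have "card ({1..l} - {i}) + 1 = l" using coord assms(1) by simp
    ultimately show ?thesis
      by (simp add: cfun.hyperplane_in_def subspace_coord_space dim_coord_space
          cspace_eq_coord_space coord_space_mono)
  next
    case diag
    then show ?thesis
      using diagonal_hyperplane[of i l j "\<zeta> ^ n"]
      by (auto simp: cfun.hyperplane_in_def cspace_eq_coord_space dim_coord_space)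
  qed
qed

lemma intermediate_arrangement_is_arrangement:
  assumes "k \<le> l"
  shows "cfun.is_arrangement l (cspace l) (intermediate_arrangement l k r \<zeta>)"
proof -
  have "cfun.span (unit_vector ` {1..l}) = cspace l"
    by (simp add: cspace_eq_coord_space coord_space_eq_span)
  then have "\<exists>B. finite B \<and> cfun.span B = cspace l" by blast
  then show ?thesis
    using assms intermediate_arrangement_hyperplane finite_intermediate_arrangement
    by (simp add: cfun.is_arrangement_def dim_coord_space cspace_eq_coord_space)
qed

lemma coordinate_hyperplane_mem:
  "1 \<le> i \<Longrightarrow> i \<le> k \<Longrightarrow> {x \<in> cspace l. x i = 0} \<in> intermediate_arrangement l k r \<zeta>"
  unfolding intermediate_arrangement_def by auto

lemma diagonal_hyperplane_mem:
  "1 \<le> i \<Longrightarrow> i < j \<Longrightarrow> j \<le> l \<Longrightarrow> n < r \<Longrightarrow>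
    {x \<in> cspace l. x i - \<zeta> ^ n * x j = 0} \<in> intermediate_arrangement l k r \<zeta>"
  unfolding intermediate_arrangement_def by blast

text \<open>Once \<open>x\<^sub>1 = 0\<close>, the hyperplanes \<open>x\<^sub>1 = x\<^sub>p\<close> restrict to coordinate hyperplanes. So the
  restriction to \<open>x\<^sub>1 = \<dots> = x\<^sub>i = 0\<close> is a full monomial arrangement as soon as \<open>i \<ge> 1\<close>. The case
  \<open>i = 0\<close> is the arrangement itself.\<close>

lemma complement_restriction_coord:
  assumes "k \<le> l" and z: "primitive_root_of_unity r \<zeta>"
    and K: "i = 0 \<and> K = {1..k} \<or> 1 \<le> i \<and> K = {i + 1..l}"
  shows "{x \<in> coord_space {i + 1..l}. \<forall>H\<in>intermediate_arrangement l k r \<zeta>.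
      \<not> coord_space {i + 1..l} \<subseteq> H \<longrightarrow> x \<notin> H} = intermediate_complement r {i + 1..l} K"
    (is "{x \<in> ?X. \<forall>H\<in>?A. \<not> ?X \<subseteq> H \<longrightarrow> x \<notin> H} = ?M")
proof (intro subset_antisym subsetI)
  have "r > 0" using z by (simp add: primitive_root_of_unity_def)
  fix x assume "x \<in> {x \<in> ?X. \<forall>H\<in>?A. \<not> ?X \<subseteq> H \<longrightarrow> x \<notin> H}"
  then have x: "x \<in> ?X" and avoid: "\<And>H. H \<in> ?A \<Longrightarrow> \<not> ?X \<subseteq> H \<Longrightarrow> x \<notin> H" by auto
  have xC: "x \<in> cspace l" using x by (auto simp: cspace_eq_coord_space coord_space_def)
  have unit: "unit_vector p \<in> ?X" if "i < p" "p \<le> l" for p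
    using that by (auto simp: coord_space_def unit_vector_def)
  have "x p \<noteq> 0" if "p \<in> K" for p
    using K
  proof
    assume i: "i = 0 \<and> K = {1..k}"
    then have p: "1 \<le> p" "p \<le> k" using that by auto
    have "unit_vector p \<notin> {x \<in> cspace l. x p = 0}" by (simp add: unit_vector_def)
    then have "x \<notin> {x \<in> cspace l. x p = 0}"
      using avoid[OF coordinate_hyperplane_mem[OF p]] unit[of p] i p assms(1) by auto
    then show ?thesis using xC by simp
  next
    assume i: "1 \<le> i \<and> K = {i + 1..l}"
    then have p: "i < p" "p \<le> l" using that by auto
    have "unit_vector p \<notin> {x \<in> cspace l. x 1 - \<zeta> ^ 0 * x p = 0}"
      using i p by (auto simp: unit_vector_def)
    then have "x \<notin> {x \<in> cspace l. x 1 - \<zeta> ^ 0 * x p = 0}"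
      using avoid[OF diagonal_hyperplane_mem[of 1 p l 0 r]] unit[OF p] i p \<open>r > 0\<close> by auto
    moreover have "x 1 = 0" using x i by (auto simp: coord_space_def)
    ultimately show ?thesis using xC by simp
  qed
  moreover have less: "x p ^ r \<noteq> x q ^ r" if pq: "i < p" "p < q" "q \<le> l" for p q
  proof
    assume "x p ^ r = x q ^ r"
    then obtain n where n: "n < r" "x p = \<zeta> ^ n * x q"
      using power_eq_iff_root_of_unity[OF z] by blast
    have "unit_vector p \<notin> {x \<in> cspace l. x p - \<zeta> ^ n * x q = 0}"
      using pq by (auto simp: unit_vector_def)
    then have "x \<notin> {x \<in> cspace l. x p - \<zeta> ^ n * x q = 0}"
      using avoid[OF diagonal_hyperplane_mem[of p q l n r]] unit[of p] pq n by auto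
    then show False using xC n by simp
  qed
  moreover have "x p ^ r \<noteq> x q ^ r" if "p \<in> {i + 1..l}" "q \<in> {i + 1..l}" "p \<noteq> q" for p q
    using that less[of p q] less[of q p] by (cases "p < q") auto
  ultimately show "x \<in> ?M" using x by (simp add: intermediate_complement_def)
next
  fix x assume x: "x \<in> ?M"
  have "x \<notin> H" if H: "H \<in> ?A" "\<not> ?X \<subseteq> H" for H
  proof
    assume "x \<in> H"
    consider (coord) p where "p \<in> {1..k}" "H = {x \<in> cspace l. x p = 0}"
      | (diag) p q n where "1 \<le> p" "p < q" "q \<le> l" "H = {x \<in> cspace l. x p - \<zeta> ^ n * x q = 0}"
      using H(1) unfolding intermediate_arrangement_def by blast
    then show False
    proof cases
      case coord
      have "i < p"
      proof (rule ccontr)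
        assume "\<not> i < p"
        then have "?X \<subseteq> H" using coord by (auto simp: cspace_eq_coord_space coord_space_def)
        then show False using H by simp
      qed
      then have "p \<in> K" using K coord assms(1) by auto
      then show False using x \<open>x \<in> H\<close> coord by (auto simp: intermediate_complement_def)
    next
      case diag
      have q: "i < q"
      proof (rule ccontr)
        assume "\<not> i < q"
        then have "?X \<subseteq> H" using diag by (auto simp: cspace_eq_coord_space coord_space_def)
        then show False using H by simp
      qed
      have eq: "x p = \<zeta> ^ n * x q" using \<open>x \<in> H\<close> diag by simp
      show False
      proof (cases "i < p")
        case True
        then have "x p ^ r \<noteq> x q ^ r" using x diag q by (auto simp: intermediate_complement_def)
        then show False using power_mult_root_of_unity[OF z] eq by simp
      next
        case False
        then have "x p = 0" using x by (auto simp: intermediate_complement_def coord_space_def)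
        moreover have "q \<in> K" using K False q diag by auto
        then have "x q \<noteq> 0" using x by (auto simp: intermediate_complement_def)
        moreover have "\<zeta> \<noteq> 0" using z by (auto simp: primitive_root_of_unity_def power_0_left)
        ultimately show False using eq by simp
      qed
    qed
  qed
  then show "x \<in> {x \<in> ?X. \<forall>H\<in>?A. \<not> ?X \<subseteq> H \<longrightarrow> x \<notin> H}"
    using x by (simp add: intermediate_complement_def)
qed

text \<open>Eliminating \<open>x\<^sub>i\<close>, the restriction of \<open>\<A>\<^sup>0\<close> to \<open>x\<^sub>i = \<zeta>\<^sup>n x\<^sub>j\<close> is an intermediate arrangement
  with the single coordinate hyperplane \<open>x\<^sub>j = 0\<close>, which comes from \<open>x\<^sub>i = \<zeta>\<^sup>m x\<^sub>j\<close> for \<open>m \<noteq> n\<close>.\<close>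

lemma complement_restriction_diagonal:
  fixes l r i j n :: nat and \<zeta> :: complex
  assumes z: "primitive_root_of_unity r \<zeta>" and "r \<ge> 2"
    and ij: "1 \<le> i" "i < j" "j \<le> l" "n < r"
  defines "X \<equiv> {x \<in> cspace l. x i - \<zeta> ^ n * x j = 0}"
  shows "{x \<in> X. \<forall>H\<in>intermediate_arrangement l 0 r \<zeta>. \<not> X \<subseteq> H \<longrightarrow> x \<notin> H} =
    {x \<in> X. x(i := 0) \<in> intermediate_complement r ({1..l} - {i}) {j}}"
    (is "{x \<in> X. \<forall>H\<in>?A. \<not> X \<subseteq> H \<longrightarrow> x \<notin> H} = {x \<in> X. ?y x \<in> ?M}")
proof (intro subset_antisym subsetI)
  fix x assume "x \<in> {x \<in> X. \<forall>H\<in>?A. \<not> X \<subseteq> H \<longrightarrow> x \<notin> H}"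
  then have x: "x \<in> X" and avoid: "\<And>H. H \<in> ?A \<Longrightarrow> \<not> X \<subseteq> H \<Longrightarrow> x \<notin> H" by auto
  have xC: "x \<in> cspace l" and xi: "x i = \<zeta> ^ n * x j" using x by (auto simp: X_def)
  \<comment> \<open>The point of \<open>X\<close> lying over the unit vector at \<open>p \<noteq> i\<close>.\<close>
  define w where "w p = (\<lambda>t. if t = p then 1 else if t = i \<and> p = j then \<zeta> ^ n else 0)" for p
  have w: "w p \<in> X" if "1 \<le> p" "p \<le> l" "p \<noteq> i" for p
    using that ij by (auto simp: w_def X_def cspace_def)
  have "x j \<noteq> 0"
  proof
    assume "x j = 0"
    obtain m where m: "m < r" "m \<noteq> n"
      using \<open>r \<ge> 2\<close> by (cases "n = 0") (auto intro: that[of 0] that[of 1])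
    then have "\<zeta> ^ n \<noteq> \<zeta> ^ m"
      using inj_on_powers_primitive_root[OF z] ij(4) by (auto dest: inj_onD)
    then have "w j \<notin> {x \<in> cspace l. x i - \<zeta> ^ m * x j = 0}" using ij by (simp add: w_def)
    then have "x \<notin> {x \<in> cspace l. x i - \<zeta> ^ m * x j = 0}"
      using avoid[OF diagonal_hyperplane_mem[OF ij(1-3) m(1)]] w[of j] ij by auto
    then show False using xC xi \<open>x j = 0\<close> by simp
  qed
  moreover have less: "x p ^ r \<noteq> x q ^ r"
    if pq: "1 \<le> p" "p < q" "q \<le> l" "p \<noteq> i" "q \<noteq> i" for p q
  proof
    assume "x p ^ r = x q ^ r"
    then obtain m where m: "m < r" "x p = \<zeta> ^ m * x q"
      using power_eq_iff_root_of_unity[OF z] by blast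
    have "w p \<notin> {x \<in> cspace l. x p - \<zeta> ^ m * x q = 0}" using pq by (simp add: w_def)
    then have "x \<notin> {x \<in> cspace l. x p - \<zeta> ^ m * x q = 0}"
      using avoid[OF diagonal_hyperplane_mem[OF pq(1-3) m(1)]] w[of p] pq by auto
    then show False using xC m by simp
  qed
  moreover have "x p ^ r \<noteq> x q ^ r"
    if "p \<in> {1..l} - {i}" "q \<in> {1..l} - {i}" "p \<noteq> q" for p q
    using that less[of p q] less[of q p] by (cases "p < q") auto
  moreover have "?y x \<in> coord_space ({1..l} - {i})"
    using xC by (auto simp: cspace_def coord_space_def)
  ultimately show "x \<in> {x \<in> X. ?y x \<in> ?M}"
    using x ij by (simp add: intermediate_complement_def)
next
  fix x assume "x \<in> {x \<in> X. ?y x \<in> ?M}"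
  then have x: "x \<in> X" and y: "?y x \<in> ?M" by auto
  have xi: "x i = \<zeta> ^ n * x j" using x by (auto simp: X_def)
  have xj: "x j \<noteq> 0" using y ij by (auto simp: intermediate_complement_def)
  have dist: "x p ^ r \<noteq> x q ^ r" if "p \<in> {1..l} - {i}" "q \<in> {1..l} - {i}" "p \<noteq> q" for p q
  proof -
    have "?y x p ^ r \<noteq> ?y x q ^ r" using y that unfolding intermediate_complement_def by blast
    then show ?thesis using that by simp
  qed
  have pow: "x i ^ r = x j ^ r" using xi power_mult_root_of_unity[OF z] by simp
  have "x \<notin> H" if H: "H \<in> ?A" "\<not> X \<subseteq> H" for H
  proof
    assume "x \<in> H"
    obtain p q m where pq: "1 \<le> p" "p < q" "q \<le> l"
      and Hpq: "H = {x \<in> cspace l. x p - \<zeta> ^ m * x q = 0}"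
      using H(1) unfolding intermediate_arrangement_def by auto
    have eq: "x p = \<zeta> ^ m * x q" using \<open>x \<in> H\<close> Hpq by simp
    then have pow': "x p ^ r = x q ^ r" using power_mult_root_of_unity[OF z] by simp
    consider "p = i" "q = j" | "p = i" "q \<noteq> j" | "q = i" | "p \<noteq> i" "q \<noteq> i" by blast
    then show False
    proof cases
      case 1
      then have "\<zeta> ^ n = \<zeta> ^ m" using xi eq xj by simp
      then show False using H(2) Hpq 1 by (simp add: X_def)
    next
      case 2
      then show False using dist[of j q] pow pow' pq ij by simp
    next
      case 3
      then show False using dist[of p j] pow pow' pq ij by simp
    next
      case 4
      then show False using dist[of p q] pow' pq by simp
    qed
  qed
  then show "x \<in> {x \<in> X. \<forall>H\<in>?A. \<not> X \<subseteq> H \<longrightarrow> x \<notin> H}" using x by blast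
qed

lemma char_poly_restriction_coord:
  assumes "k \<le> l" "i < l" and z: "primitive_root_of_unity r \<zeta>"
    and K: "i = 0 \<and> K = {1..k} \<or> 1 \<le> i \<and> K = {i + 1..l}"
  shows "cfun.char_poly_arr (coord_space {i + 1..l})
      (restriction (intermediate_arrangement l k r \<zeta>) (coord_space {i + 1..l})) =
    monomial_poly r (l - i - 1) *
      [:- ((int (l - i) - 1) * int r + 1 - int (l - i) + int (card K)), 1:]"
proof (rule cfun.char_poly_restriction_eqI[OF finite_intermediate_arrangement subspace_coord_space])
  show "cfun.subspace H" if "H \<in> intermediate_arrangement l k r \<zeta>" for H
    using intermediate_arrangement_hyperplane[OF assms(1) that] by (simp add: cfun.hyperplane_in_def)
  show "{x \<in> coord_space {i + 1..l}. \<forall>H\<in>intermediate_arrangement l k r \<zeta>.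
      \<not> coord_space {i + 1..l} \<subseteq> H \<longrightarrow> x \<notin> H} = intermediate_complement r {i + 1..l} K"
    by (rule complement_restriction_coord[OF assms(1) z K])
  have "K \<subseteq> {i + 1..l}" using K assms(1) by auto
  then show "cfun.subspace_valuation (coord_space {i + 1..l})
      (indicator (intermediate_complement r {i + 1..l} K))
      (monomial_poly r (l - i - 1) *
        [:- ((int (l - i) - 1) * int r + 1 - int (l - i) + int (card K)), 1:])"
    using valuation_intermediate_complement[of "{i + 1..l}" K r \<zeta>] assms(2) z by simp
qed

lemma char_poly_restriction_diagonal:
  fixes l r i j n :: nat and \<zeta> :: complex
  assumes z: "primitive_root_of_unity r \<zeta>" and "r \<ge> 2"
    and ij: "1 \<le> i" "i < j" "j \<le> l" "n < r"
  defines "X \<equiv> {x \<in> cspace l. x i - \<zeta> ^ n * x j = 0}"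
  shows "cfun.char_poly_arr X (restriction (intermediate_arrangement l 0 r \<zeta>) X) =
    monomial_poly r (l - 2) * [:- ((int l - 2) * int r + 3 - int l), 1:]"
proof -
  let ?S = "{1..l} - {i}"
  let ?q = "monomial_poly r (l - 2) * [:- ((int l - 2) * int r + 3 - int l), 1:]"
  let ?M = "intermediate_complement r ?S {j}"
  have ins: "insert i ?S = {1..l}" using ij by auto
  have card: "card ?S = l - 1" using ij by simp
  have int: "int (l - 1) = int l - 1" using ij by simp
  have "l - 1 - 1 = l - 2" by simp
  have coeff: "(int l - 1 - 1) * int r + 1 - (int l - 1) + int (card {j}) =
      (int l - 2) * int r + 3 - int l" by simp
  have "j \<in> ?S" using ij by simp
  then have "finite ?S" "?S \<noteq> {}" "{j} \<subseteq> ?S" by blast+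
  from valuation_intermediate_complement[OF this z]
  have "cfun.subspace_valuation (coord_space ?S) (indicator ?M) ?q"
    unfolding card int coeff \<open>l - 1 - 1 = l - 2\<close> .
  then have "cfun.subspace_valuation UNIV (\<lambda>x. indicator ?M (x(i := 0)) *
      indicator {x \<in> coord_space (insert i ?S). x i = \<zeta> ^ n * x j} x) ?q"
    by (rule valuation_graph) (use ij in auto)
  moreover have "(\<lambda>x. indicator ?M (x(i := 0)) *
      indicator {x \<in> coord_space (insert i ?S). x i = \<zeta> ^ n * x j} x :: int) =
      indicator {x \<in> X. x(i := 0) \<in> ?M}"
    unfolding ins X_def cspace_eq_coord_space by (auto simp: fun_eq_iff indicator_def)
  ultimately have val: "cfun.subspace_valuation UNIV (indicator {x \<in> X. x(i := 0) \<in> ?M}) ?q"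
    by simp
  show ?thesis
  proof (rule cfun.char_poly_restriction_eqI[OF finite_intermediate_arrangement _ _ _ val])
    show "cfun.subspace X" unfolding X_def using ij by (intro diagonal_hyperplane(1)) auto
    show "cfun.subspace H" if "H \<in> intermediate_arrangement l 0 r \<zeta>" for H
      using intermediate_arrangement_hyperplane[OF _ that] by (simp add: cfun.hyperplane_in_def)
    show "{x \<in> X. \<forall>H\<in>intermediate_arrangement l 0 r \<zeta>. \<not> X \<subseteq> H \<longrightarrow> x \<notin> H} =
        {x \<in> X. x(i := 0) \<in> ?M}"
      unfolding X_def by (rule complement_restriction_diagonal[OF z assms(2) ij])
  qed
qed


section \<open>Divisional freeness\<close>

lemma intermediate_divisionally_free:
  assumes "k \<le> l" "k \<noteq> 0" and z: "primitive_root_of_unity r \<zeta>"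
  shows "cfun.divisionally_free l (cspace l) (intermediate_arrangement l k r \<zeta>)"
proof -
  let ?A = "intermediate_arrangement l k r \<zeta>"
  let ?X = "\<lambda>i. coord_space {i + 1..l}"
  have "r > 0" using z by (simp add: primitive_root_of_unity_def)
  have "?X i \<in> cfun.lattice_codim (cspace l) ?A i" if "i + 2 \<le> l" for i
  proof -
    have "?X i \<in> intersection_lattice (cspace l) ?A"
    proof (cases "i = 0")
      case True
      then have "?X i = cspace l \<inter> \<Inter>{}" by (simp add: cspace_eq_coord_space)
      then show ?thesis unfolding intersection_lattice_def by blast
    next
      case False
      \<comment> \<open>Of the coordinate hyperplanes only \<open>x\<^sub>1 = 0\<close> is certain to be available; \<open>x\<^sub>1 = x\<^sub>p\<close> kills the
        other coordinates.\<close>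
      let ?H = "{x \<in> cspace l. x 1 = 0}"
      let ?D = "\<lambda>p. {x \<in> cspace l. x 1 - \<zeta> ^ 0 * x p = 0}"
      let ?B = "insert ?H (?D ` {2..i})"
      have "?H \<in> ?A" using assms(2) by (intro coordinate_hyperplane_mem) auto
      moreover have "?D p \<in> ?A" if "p \<in> {2..i}" for p
        using that \<open>i + 2 \<le> l\<close> \<open>r > 0\<close> by (intro diagonal_hyperplane_mem) auto
      ultimately have "?B \<subseteq> ?A" by blast
      moreover have "?X i = cspace l \<inter> \<Inter>?B"
      proof (intro subset_antisym subsetI)
        fix x assume "x \<in> ?X i"
        then show "x \<in> cspace l \<inter> \<Inter>?B" using False by (auto simp: coord_space_def cspace_def)
      next
        fix x assume x: "x \<in> cspace l \<inter> \<Inter>?B"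
        then have "x 1 = 0" by auto
        moreover have "x 1 = x p" if "p \<in> {2..i}" for p
        proof -
          have "x \<in> ?D p" using x that by blast
          then show ?thesis by simp
        qed
        ultimately have "x p = 0" if "p \<in> {1..i}" for p
          using that by (cases "p = 1") auto
        moreover have "x p = 0" if "p \<notin> {1..l}" for p using x that by (auto simp: cspace_def)
        ultimately show "x \<in> ?X i"
          unfolding coord_space_def mem_Collect_eq
          by (metis Suc_eq_plus1 atLeastAtMost_iff not_less_eq_eq)
      qed
      ultimately show ?thesis unfolding intersection_lattice_def by blast
    qed
    then show ?thesis using that
      by (simp add: cfun.lattice_codim_def dim_coord_space cspace_eq_coord_space)
  qed
  moreover have "?X (Suc i) \<subset> ?X i" if "i + 3 \<le> l" for i
  proof -
    have "unit_vector (i + 1) \<in> ?X i - ?X (Suc i)"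
      using that by (auto simp: coord_space_def unit_vector_def)
    moreover have "?X (Suc i) \<subseteq> ?X i" by (intro coord_space_mono) auto
    ultimately show ?thesis by blast
  qed
  moreover have "cfun.char_poly_arr (?X (Suc i)) (restriction ?A (?X (Suc i))) dvd
      cfun.char_poly_arr (?X i) (restriction ?A (?X i))" if "i + 3 \<le> l" for i
  proof -
    have "\<exists>d. l = (i + 2) + d" using that by (intro le_Suc_ex) simp
    then obtain d where "l = i + 2 + d" ..
    then have d: "l - i - 1 = Suc d" "l - Suc i = Suc d" "card {Suc i + 1..l} = Suc d" by auto
    then have "monomial_poly r (l - i - 1) = monomial_poly r (l - Suc i - 1) *
        [:- ((int (l - Suc i) - 1) * int r + 1 - int (l - Suc i) + int (card {Suc i + 1..l})), 1:]"
      unfolding d by (simp add: monomial_poly_def)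
    also have "\<dots> = cfun.char_poly_arr (?X (Suc i)) (restriction ?A (?X (Suc i)))"
      using that by (intro char_poly_restriction_coord[OF assms(1) _ z, symmetric]) auto
    finally have lower: "cfun.char_poly_arr (?X (Suc i)) (restriction ?A (?X (Suc i))) =
        monomial_poly r (l - i - 1)" by simp
    let ?K = "if i = 0 then {1..k} else {i + 1..l}"
    show ?thesis
      unfolding lower using that
      by (subst char_poly_restriction_coord[OF assms(1) _ z, of i ?K]) (auto simp del: mult_pCons_right)
  qed
  ultimately show ?thesis
    unfolding cfun.divisionally_free_def
    using intermediate_arrangement_is_arrangement[OF assms(1)]
    by (intro conjI exI[of _ ?X]) (auto simp: cspace_eq_coord_space)
qed

lemma lattice_codim_1_intermediate:
  assumes "k \<le> l" "1 \<le> l"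
    and X: "X \<in> cfun.lattice_codim (cspace l) (intermediate_arrangement l k r \<zeta>) 1"
  shows "X \<in> intermediate_arrangement l k r \<zeta>"
proof -
  let ?A = "intermediate_arrangement l k r \<zeta>"
  have dimV: "cfun.dim (cspace l) = l" by (simp add: cspace_eq_coord_space dim_coord_space)
  obtain B where B: "B \<subseteq> ?A" "X = cspace l \<inter> \<Inter>B" and dimX: "cfun.dim X + 1 = l"
    using X dimV by (auto simp: cfun.lattice_codim_def intersection_lattice_def)
  have "B \<noteq> {}" using B dimX dimV by auto
  then obtain H where H: "H \<in> B" by blast
  have hyp: "cfun.hyperplane_in (cspace l) H'" if "H' \<in> B" for H'
    using B(1) that intermediate_arrangement_hyperplane[OF assms(1)] by blast
  have "X = H"
  proof (rule cfun.subspace_eq_if_dim_le)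
    show "cfun.subspace X"
      unfolding B(2) using hyp subspace_coord_space
      by (auto simp: cspace_eq_coord_space cfun.hyperplane_in_def
          intro!: cfun.subspace_inter cfun.subspace_Inter)
    show "cfun.subspace H" using hyp[OF H] by (simp add: cfun.hyperplane_in_def)
    show "X \<subseteq> H" using B(2) H by blast
    show "H \<subseteq> cfun.span (unit_vector ` {1..l})"
      using hyp[OF H]
      by (simp add: cfun.hyperplane_in_def cspace_eq_coord_space flip: coord_space_eq_span)
    show "finite (unit_vector ` {1..l})" by simp
    show "cfun.dim H \<le> cfun.dim X" using hyp[OF H] dimX dimV by (simp add: cfun.hyperplane_in_def)
  qed
  then show ?thesis using B(1) H by blast
qed

lemma not_divisionally_free_if_no_coordinate_hyperplane:
  assumes "l \<ge> 3" "r \<ge> 3" and z: "primitive_root_of_unity r \<zeta>"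
  shows "\<not> cfun.divisionally_free l (cspace l) (intermediate_arrangement l 0 r \<zeta>)"
proof
  let ?A = "intermediate_arrangement l 0 r \<zeta>"
  let ?P = "monomial_poly r (l - 2)"
  let ?a = "(int l - 2) * int r + 3 - int l"
  let ?b = "(int l - 1) * int r + 1 - int l"
  let ?c = "(int l - 2) * int r + 1"
  assume "cfun.divisionally_free l (cspace l) ?A"
  then obtain X where X0: "X 0 = cspace l"
    and lat: "\<And>i. i + 2 \<le> l \<Longrightarrow> X i \<in> cfun.lattice_codim (cspace l) ?A i"
    and dvd: "\<And>i. i + 3 \<le> l \<Longrightarrow> cfun.char_poly_arr (X (Suc i)) (restriction ?A (X (Suc i))) dvd
        cfun.char_poly_arr (X i) (restriction ?A (X i))"
    unfolding cfun.divisionally_free_def by blast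
  have "X 1 \<in> ?A" using lattice_codim_1_intermediate[OF _ _ lat[of 1]] assms(1) by simp
  then obtain i j n where ij: "1 \<le> i" "i < j" "j \<le> l" "n < r"
    and X1: "X 1 = {x \<in> cspace l. x i - \<zeta> ^ n * x j = 0}"
    unfolding intermediate_arrangement_def by auto
  have lower: "cfun.char_poly_arr (X 1) (restriction ?A (X 1)) = ?P * [:- ?a, 1:]"
    unfolding X1 using assms(2) by (intro char_poly_restriction_diagonal[OF z _ ij]) simp
  have "cfun.char_poly_arr (X 0) (restriction ?A (X 0)) = monomial_poly r (l - 1) * [:- ?b, 1:]"
    using char_poly_restriction_coord[of 0 l 0 r \<zeta> "{}"] z assms(1)
    by (simp add: X0 cspace_eq_coord_space)
  also have "monomial_poly r (l - 1) = ?P * [:- ?c, 1:]"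
  proof -
    have "l - 1 = Suc (l - 2)" "int (l - 2) = int l - 2" using assms(1) by auto
    then show ?thesis by (simp add: monomial_poly_def)
  qed
  finally have upper: "cfun.char_poly_arr (X 0) (restriction ?A (X 0)) =
      ?P * ([:- ?c, 1:] * [:- ?b, 1:])" by (simp only: mult.assoc)
  have "0 + 3 \<le> l" using assms(1) by simp
  from dvd[OF this] have "?P * [:- ?a, 1:] dvd ?P * ([:- ?c, 1:] * [:- ?b, 1:])"
    unfolding One_nat_def[symmetric] lower upper .
  moreover have "?P \<noteq> 0" by (simp add: monomial_poly_def)
  ultimately have "[:- ?a, 1:] dvd [:- ?c, 1:] * [:- ?b, 1:]" by (simp only: dvd_mult_cancel_left) simp
  then have "poly ([:- ?c, 1:] * [:- ?b, 1:]) ?a = 0" by (simp only: poly_eq_0_iff_dvd)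
  moreover have "poly ([:- ?c, 1:] * [:- ?b, 1:]) ?a = (?a - ?c) * (?a - ?b)"
    unfolding poly_mult by simp
  ultimately have "?a = ?c \<or> ?a = ?b" by (simp only: mult_eq_0_iff right_minus_eq)
  moreover have "?a \<noteq> ?c" using assms(1) by simp
  moreover have "?b - ?a = int r - 2" by (simp add: algebra_simps)
  ultimately show False using assms(2) by linarith
qed

theorem theorem5p6:
  fixes l k r :: nat and \<zeta> :: complex
  assumes "l \<ge> 3" and "k \<le> l" and "r > 0"
    and "primitive_root_of_unity r \<zeta>"
    and "k = 0 \<Longrightarrow> r \<ge> 3"
  shows "(cspace l, intermediate_arrangement l k r \<zeta>) \<in> cfun.DF \<longleftrightarrow> k \<noteq> 0"
proof
  assume "k \<noteq> 0"
  then show "(cspace l, intermediate_arrangement l k r \<zeta>) \<in> cfun.DF"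
    using intermediate_divisionally_free[of k l r \<zeta>] assms
    by (auto simp: cfun.DF_def cfun.DF_dim_def intro!: bexI[of _ l])
next
  assume "(cspace l, intermediate_arrangement l k r \<zeta>) \<in> cfun.DF"
  then obtain m where m: "cfun.divisionally_free m (cspace l) (intermediate_arrangement l k r \<zeta>)"
    by (auto simp: cfun.DF_def cfun.DF_dim_def)
  then have "m = l"
    by (simp add: cfun.divisionally_free_def cfun.is_arrangement_def cspace_eq_coord_space
        dim_coord_space)
  then show "k \<noteq> 0"
    using not_divisionally_free_if_no_coordinate_hyperplane[OF assms(1) _ assms(4)] assms(5) m by metis
qed

end
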